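(* Let $Z$ be a finite set of integers that is the imbalance set of some tournament, and let $\mathrm{ord}(Z)$ denote the minimal order of a tournament with imbalance set $Z$. Let $X=\{x_1,\ldots,x_l\}$ be the set of non-negative elements of $Z$ and $Y=\{-y_1,\ldots,-y_m\}$ the set of negative elements of $Z$, let $L=\sum_{i=1}^{l}x_i$, $M=\sum_{i=1}^{m}y_i$ and $n=lM+mL$. (i) If $Z$ consists of odd integers, then $\mathrm{ord}(Z)\leq n$. (ii) If $Z$ consists of even integers and $0\in Z$, then $\mathrm{ord}(Z)\leq n+1$. (iii) If $Z$ consists of even integers and $0\notin Z$, then $\mathrm{ord}(Z)<2n$.
   Context: A tournament is an orientation of a complete simple graph; its order is its number of vertices. The imbalance of a vertex $v$ in a digraph is $d^{+}(v)-d^{-}(v)$ (outdegree minus indegree), and the imbalance set of a digraph is the set of imbalances of its vertices. *)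

theory Defs
  imports "Graph_Theory.Graph_Theory"
begin

text \<open>
  \<open>pair_digraph\<close> provides finiteness and the absence of loops and parallel arcs. As usual, a
  tournament has at least one vertex: the null digraph would have the empty imbalance set.
\<close>

locale tournament = pair_digraph G for G :: "'v pair_pre_digraph" +
  assumes verts_nonempty: "pverts G \<noteq> {}"
    and one_arc: "\<And>u v. u \<in> pverts G \<Longrightarrow> v \<in> pverts G \<Longrightarrow> u \<noteq> v \<Longrightarrow>
      ((u, v) \<in> parcs G) \<noteq> ((v, u) \<in> parcs G)"

definition imbalance :: "('v, 'e) pre_digraph \<Rightarrow> 'v \<Rightarrow> int" where
  "imbalance G v = int (out_degree G v) - int (in_degree G v)"

definition imbalance_set :: "('v, 'e) pre_digraph \<Rightarrow> int set" where
  "imbalance_set G = imbalance G ` verts G"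

text \<open>
  Every finite digraph is isomorphic to one whose vertices are natural numbers, so the minimum
  may be taken over such tournaments. It is only meaningful when \<open>Z\<close> is the imbalance set of
  some tournament.
\<close>

definition tournament_ord :: "int set \<Rightarrow> nat" where
  "tournament_ord Z = (LEAST k. \<exists>T :: nat pair_pre_digraph.
     tournament T \<and> imbalance_set (with_proj T) = Z \<and> card (pverts T) = k)"

end

theory Submission
  imports Defs
begin

text \<open>
  By a version of Landau's theorem, integers of the right parity with sum zero are the imbalances
  of a tournament on \<open>V\<close> as soon as every \<open>A \<subseteq> V\<close> has sum at least \<open>- |A| |V - A|\<close>: in a
  tournament closest to the prescribed imbalances, a path from a vertex with too large an
  imbalance to one with too small an imbalance could be reversed, which would bring it closer.
  The condition on subsets holds whenever no entry exceeds the number of negative entries and no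
  negated entry exceeds the number of non-negative ones. Taking \<open>M\<close> copies of each
  element of \<open>X\<close> and \<open>L\<close> copies of each element of \<open>Y\<close> achieves this with sum zero and an even
  order \<open>n\<close>, which is (i). If the elements are even, the order must be odd: in (ii) one more zero
  is added. In (iii) let \<open>g = Gcd Z\<close>. The quotients \<open>z div g\<close> are not all even by the choice of \<open>g\<close>,
  and not all odd since an odd number of them, counted with multiplicity in the given
  tournament, sums to zero; so some \<open>x > 0 > y\<close> in
  \<open>Z\<close> have \<open>(x - y) div g\<close> odd, and \<open>- y div g\<close> copies of \<open>x\<close> and \<open>x div g\<close> copies of \<open>y\<close> are
  added, which is at most \<open>n div 2\<close> vertices because \<open>g \<ge> 2\<close>.
\<close>

section \<open>Imbalances and arc reversal\<close>

text \<open>This is the skew-adjacency matrix. Its row sums are the imbalances, and its antisymmetry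
  does the cancelling below.\<close>

definition arc_sign :: "'a pair_pre_digraph \<Rightarrow> 'a \<Rightarrow> 'a \<Rightarrow> int" where
  "arc_sign T u v = of_bool ((u, v) \<in> parcs T) - of_bool ((v, u) \<in> parcs T)"

lemma arc_sign_minus: "arc_sign T v u = - arc_sign T u v"
  by (simp add: arc_sign_def)

lemma (in tournament) odd_arc_sign:
  assumes "u \<in> pverts G" "v \<in> pverts G" "u \<noteq> v"
  shows "odd (arc_sign G u v)"
  using one_arc[OF assms] by (auto simp: arc_sign_def)

lemma (in pair_digraph) imbalance_eq_sum_arc_sign:
  "imbalance (with_proj G) u = (\<Sum>v\<in>pverts G. arc_sign G u v)"
proof -
  have out: "out_arcs (with_proj G) u = Pair u ` {v \<in> pverts G. (u, v) \<in> parcs G}"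
    using in_arcsD2 by (auto simp: out_arcs_def)
  have inc: "in_arcs (with_proj G) u = (\<lambda>v. (v, u)) ` {v \<in> pverts G. (v, u) \<in> parcs G}"
    using in_arcsD1 by (auto simp: in_arcs_def)
  have fin: "finite (pverts G)" by simp
  have "out_degree (with_proj G) u = card {v \<in> pverts G. (u, v) \<in> parcs G}"
    unfolding out_degree_def out by (rule card_image) (simp add: inj_on_def)
  moreover have "in_degree (with_proj G) u = card {v \<in> pverts G. (v, u) \<in> parcs G}"
    unfolding in_degree_def inc by (rule card_image) (simp add: inj_on_def)
  ultimately show ?thesis
    using fin by (simp add: imbalance_def arc_sign_def sum_subtractf sum_of_bool_eq Int_def)
qed

text \<open>An arc inside \<open>A\<close> counts once with each sign, so only the arcs across the
  cut survive.\<close>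

lemma (in pair_digraph) sum_imbalance_eq:
  assumes "A \<subseteq> pverts G"
  shows "(\<Sum>u\<in>A. imbalance (with_proj G) u) = (\<Sum>u\<in>A. \<Sum>v\<in>pverts G - A. arc_sign G u v)"
proof -
  have "(\<Sum>u\<in>A. \<Sum>v\<in>A. arc_sign G u v) = (\<Sum>v\<in>A. \<Sum>u\<in>A. arc_sign G u v)"
    by (rule sum.swap)
  also have "\<dots> = - (\<Sum>v\<in>A. \<Sum>u\<in>A. arc_sign G v u)"
    by (subst arc_sign_minus) (simp add: sum_negf)
  finally have "(\<Sum>u\<in>A. \<Sum>v\<in>A. arc_sign G u v) = 0" by simp
  moreover have "(\<Sum>v\<in>pverts G. arc_sign G u v)
      = (\<Sum>v\<in>pverts G - A. arc_sign G u v) + (\<Sum>v\<in>A. arc_sign G u v)" for u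
    using assms by (intro sum.subset_diff) auto
  ultimately show ?thesis
    by (simp add: imbalance_eq_sum_arc_sign sum.distrib)
qed

lemma (in pair_digraph) sum_imbalance_eq_0: "(\<Sum>u\<in>pverts G. imbalance (with_proj G) u) = 0"
  by (subst sum_imbalance_eq) auto

text \<open>Each of the \<open>card (pverts G) - 1\<close> other vertices contributes an odd
  sign.\<close>

lemma (in tournament) even_imbalance_iff:
  assumes u: "u \<in> pverts G"
  shows "even (imbalance (with_proj G) u) \<longleftrightarrow> odd (card (pverts G))"
proof -
  have fin: "finite (pverts G)" by simp
  have "imbalance (with_proj G) u = arc_sign G u u + (\<Sum>v\<in>pverts G - {u}. arc_sign G u v)"
    unfolding imbalance_eq_sum_arc_sign using u fin by (rule sum.remove[rotated])
  moreover have "arc_sign G u u = 0" by (simp add: arc_sign_def)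
  moreover have "even (\<Sum>v\<in>pverts G - {u}. arc_sign G u v) \<longleftrightarrow>
      even (card {v \<in> pverts G - {u}. odd (arc_sign G u v)})"
    using fin by (intro even_sum_iff) auto
  moreover have "{v \<in> pverts G - {u}. odd (arc_sign G u v)} = pverts G - {u}"
    using odd_arc_sign u by auto
  moreover have "card (pverts G - {u}) + 1 = card (pverts G)"
    using u fin by (metis Suc_eq_plus1 card_Suc_Diff1)
  ultimately show ?thesis by (metis add_0 even_plus_one_iff)
qed

lemma (in tournament) reverse_arc:
  assumes wv: "(w, v) \<in> parcs G"
  defines "G' \<equiv> G\<lparr>parcs := insert (v, w) (parcs G - {(w, v)})\<rparr>"
  shows "tournament G'"
    and "imbalance (with_proj G') x = imbalance (with_proj G) x - 2 * of_bool (x = w) + 2 * of_bool (x = v)"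
proof -
  have V: "w \<in> pverts G" "v \<in> pverts G" and ne: "w \<noteq> v"
    using in_arcsD1[OF wv] in_arcsD2[OF wv] no_loops[of "(w, v)"] wv by auto
  have nvw: "(v, w) \<notin> parcs G" using one_arc[OF V ne] wv by blast
  show G': "tournament G'"
  proof unfold_locales
    fix e assume "e \<in> parcs G'"
    then show "fst e \<in> pverts G'" "snd e \<in> pverts G'" "fst e \<noteq> snd e"
      using V ne in_arcsD1 in_arcsD2 no_loops by (cases e; auto simp: G'_def)+
  next
    show "finite (pverts G')" "finite (parcs G')" "pverts G' \<noteq> {}"
      using verts_nonempty by (simp_all add: G'_def)
  next
    fix a b assume "a \<in> pverts G'" "b \<in> pverts G'" "a \<noteq> b"
    then show "((a, b) \<in> parcs G') \<noteq> ((b, a) \<in> parcs G')"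
      using one_arc[of a b] wv nvw ne by (auto simp: G'_def)
  qed
  interpret G': tournament G' by (rule G')
  have "arc_sign G' x y = arc_sign G x y - 2 * (if v = y then of_bool (x = w) else 0)
      + 2 * (if w = y then of_bool (x = v) else 0)" for y
    using wv nvw ne by (auto simp: arc_sign_def G'_def)
  moreover have "pverts G' = pverts G" by (simp add: G'_def)
  ultimately show "imbalance (with_proj G') x
      = imbalance (with_proj G) x - 2 * of_bool (x = w) + 2 * of_bool (x = v)"
    using V by (simp add: imbalance_eq_sum_arc_sign G'.imbalance_eq_sum_arc_sign sum.distrib
        sum_subtractf flip: sum_distrib_left)
qed

text \<open>The arcs are reversed one after the other. An inner vertex gains 2 as the head of one
  arc and loses 2 as the tail of the next, so only the two ends change.\<close>

lemma reverse_path: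
  assumes "tournament G" "distinct (w # xs)" "successively (\<lambda>a b. (a, b) \<in> parcs G) (w # xs)"
  shows "\<exists>G'. tournament G' \<and> pverts G' = pverts G \<and>
    (\<forall>x. imbalance (with_proj G') x
      = imbalance (with_proj G) x - 2 * of_bool (x = w) + 2 * of_bool (x = last (w # xs)))"
  using assms
proof (induction xs arbitrary: w G)
  case Nil
  then show ?case by (intro exI[of _ G]) auto
next
  case (Cons v xs)
  interpret tournament G by (rule Cons.prems)
  define H where "H = G\<lparr>parcs := insert (v, w) (parcs G - {(w, v)})\<rparr>"
  have wv: "(w, v) \<in> parcs G" using Cons.prems by simp
  note H = reverse_arc[OF wv, folded H_def]
  have "successively (\<lambda>a b. (a, b) \<in> parcs G) (v # xs)" using Cons.prems by simp
  then have "successively (\<lambda>a b. (a, b) \<in> parcs H) (v # xs)"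
    \<comment> \<open>By distinctness \<open>w\<close> is not on the remaining path, so the reversed
      arc leaves that path intact.\<close>
    by (rule successively_mono) (use Cons.prems in \<open>auto simp: H_def\<close>)
  then obtain G' where "tournament G'" "pverts G' = pverts H"
    "\<forall>x. imbalance (with_proj G') x
      = imbalance (with_proj H) x - 2 * of_bool (x = v) + 2 * of_bool (x = last (v # xs))"
    using Cons.IH[OF H(1), of v] Cons.prems(2) by auto
  then show ?case
    using H(2) by (intro exI[of _ G']) (auto simp: H_def)
qed

lemma rtrancl_imp_distinct_path:
  assumes "(w, u) \<in> r\<^sup>*"
  shows "\<exists>xs. distinct (w # xs) \<and> successively (\<lambda>a b. (a, b) \<in> r) (w # xs) \<and> last (w # xs) = u"
  using assms
proof (induction rule: converse_rtrancl_induct)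
  case base
  show ?case by (intro exI[of _ "[]"]) simp
next
  case (step w v)
  then obtain xs where xs: "distinct (v # xs)" "successively (\<lambda>a b. (a, b) \<in> r) (v # xs)"
    "last (v # xs) = u" by blast
  show ?case
  proof (cases "w \<in> set (v # xs)")
    case True
    \<comment> \<open>The path already visits \<open>w\<close>; dropping everything before that
      visit leaves a path that starts there.\<close>
    then obtain as bs where "v # xs = as @ w # bs" by (meson split_list)
    with xs show ?thesis
      by (intro exI[of _ bs]) (auto simp: successively_append_iff)
  next
    case False
    with xs step show ?thesis by (intro exI[of _ "v # xs"]) auto
  qed
qed

section \<open>Landau's theorem\<close>

text \<open>A transitive tournament, ordered by an injective numbering, serves as the start of the
  descent in \<open>landau\<close>.\<close>

lemma ex_tournament:
  fixes V :: "'a set"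
  assumes "finite V" "V \<noteq> {}"
  shows "\<exists>T. tournament T \<and> pverts T = V"
proof -
  obtain f :: "'a \<Rightarrow> nat" where f: "inj_on f V"
    using finite_imp_inj_to_nat_seg[OF assms(1)] by blast
  define T where "T = \<lparr>pverts = V, parcs = {(u, v) \<in> V \<times> V. f u < f v}\<rparr>"
  have "parcs T \<subseteq> V \<times> V" by (auto simp: T_def)
  then have "finite (parcs T)" using assms(1) by (meson finite_SigmaI finite_subset)
  then have "tournament T"
    using assms f by unfold_locales (auto simp: T_def inj_on_def, (metis nat_neq_iff)+)
  then show ?thesis by (auto simp: T_def)
qed

theorem landau:
  fixes b :: "'a \<Rightarrow> int"
  assumes fin: "finite V" and ne: "V \<noteq> {}"
    and sum0: "(\<Sum>v\<in>V. b v) = 0"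
    and parity: "\<And>v. v \<in> V \<Longrightarrow> even (b v) \<longleftrightarrow> odd (card V)"
    and cut: "\<And>A. A \<subseteq> V \<Longrightarrow> - (int (card A) * int (card (V - A))) \<le> (\<Sum>v\<in>A. b v)"
  shows "\<exists>T. tournament T \<and> pverts T = V \<and> (\<forall>v\<in>V. imbalance (with_proj T) v = b v)"
proof -
  have "\<exists>T'. tournament T' \<and> pverts T' = V \<and> (\<forall>v\<in>V. imbalance (with_proj T') v = b v)"
    if "tournament T" "pverts T = V" for T
    using that
  \<comment> \<open>The total deviation from \<open>b\<close> decreases until it vanishes.\<close>
  proof (induction T rule: measure_induct_rule[where
        f = "\<lambda>T. nat (\<Sum>v\<in>V. \<bar>imbalance (with_proj T) v - b v\<bar>)"])
    case (less T)
    interpret tournament T by (rule less.prems)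
    let ?d = "imbalance (with_proj T)"
    note V = \<open>pverts T = V\<close>
    show ?case
    proof (cases "\<forall>v\<in>V. ?d v = b v")
      case True
      with less.prems show ?thesis by blast
    next
      case False
      have sumd: "(\<Sum>v\<in>V. ?d v) = 0" using sum_imbalance_eq_0 V by simp
      have ex: "\<exists>w\<in>V. b w < ?d w"
      proof (rule ccontr)
        assume "\<not> (\<exists>w\<in>V. b w < ?d w)"
        then have "\<forall>w\<in>V. ?d w \<le> b w" by force
        moreover from this False have "\<exists>w\<in>V. ?d w < b w" by force
        ultimately have "(\<Sum>v\<in>V. ?d v) < (\<Sum>v\<in>V. b v)" using fin by (intro sum_strict_mono_ex1) auto
        with sumd sum0 show False by simp
      qed
      define R where "R = {u \<in> V. \<exists>w\<in>V. b w < ?d w \<and> (w, u) \<in> (parcs T)\<^sup>*}"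
      have RV: "R \<subseteq> V" by (auto simp: R_def)
      have finR: "finite R" using RV fin by (rule finite_subset)
      \<comment> \<open>Otherwise \<open>R\<close> absorbs all arcs between \<open>R\<close> and its complement, so its imbalances
        sum to the least value that the hypothesis \<open>cut\<close> allows, while they exceed \<open>b\<close>.\<close>
      have "\<exists>u\<in>R. ?d u < b u"
      proof (rule ccontr)
        assume "\<not> (\<exists>u\<in>R. ?d u < b u)"
        then have "\<forall>u\<in>R. b u \<le> ?d u" by force
        moreover have "\<exists>u\<in>R. b u < ?d u" using ex by (auto simp: R_def)
        ultimately have lt: "(\<Sum>v\<in>R. b v) < (\<Sum>v\<in>R. ?d v)"
          using finR by (intro sum_strict_mono_ex1) auto
        have "arc_sign T u v = - 1" if "u \<in> R" "v \<in> V - R" for u v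
        proof -
          have "(u, v) \<notin> parcs T"
            using that by (auto simp: R_def intro: rtrancl_into_rtrancl)
          moreover have "(v, u) \<in> parcs T"
            using one_arc[of u v] that calculation RV V by auto
          ultimately show ?thesis by (simp add: arc_sign_def)
        qed
        then have "(\<Sum>v\<in>R. ?d v) = - (int (card R) * int (card (V - R)))"
          using sum_imbalance_eq[of R] RV V by simp
        with lt cut[OF RV] show False by simp
      qed
      then obtain u w where uw: "u \<in> V" "w \<in> V" "?d u < b u" "b w < ?d w" "(w, u) \<in> (parcs T)\<^sup>*"
        by (auto simp: R_def)
      obtain xs where "distinct (w # xs)" "successively (\<lambda>a b. (a, b) \<in> parcs T) (w # xs)"
        "last (w # xs) = u"
        using rtrancl_imp_distinct_path[OF uw(5)] by blast
      then obtain T' where T': "tournament T'" "pverts T' = V"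
        and d': "\<And>x. imbalance (with_proj T') x = ?d x - 2 * of_bool (x = w) + 2 * of_bool (x = u)"
        using reverse_path[OF less.prems(1), of w xs] V by auto
      \<comment> \<open>Both values have the parity fixed by \<open>card V\<close>. Hence they
        differ by at least 2 at \<open>u\<close> and at \<open>w\<close>, and the shift by 2 does
        not overshoot.\<close>
      have gap: "even (?d v - b v)" if "v \<in> V" for v
        using even_imbalance_iff[of v] parity[of v] that V by auto
      have u2: "?d u + 2 \<le> b u" using gap[OF uw(1)] uw(3) by presburger
      have w2: "b w + 2 \<le> ?d w" using gap[OF uw(2)] uw(4) by presburger
      have "(\<Sum>v\<in>V. \<bar>imbalance (with_proj T') v - b v\<bar>) < (\<Sum>v\<in>V. \<bar>?d v - b v\<bar>)"
      proof (rule sum_strict_mono_ex1[OF fin])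
        show "\<forall>v\<in>V. \<bar>imbalance (with_proj T') v - b v\<bar> \<le> \<bar>?d v - b v\<bar>"
          using u2 w2 by (auto simp: d')
        show "\<exists>v\<in>V. \<bar>imbalance (with_proj T') v - b v\<bar> < \<bar>?d v - b v\<bar>"
          using u2 w2 uw(1) by (intro bexI[of _ u]) (auto simp: d')
      qed
      moreover have "0 \<le> (\<Sum>v\<in>V. \<bar>imbalance (with_proj T') v - b v\<bar>)"
        by (intro sum_nonneg) simp
      ultimately have "nat (\<Sum>v\<in>V. \<bar>imbalance (with_proj T') v - b v\<bar>) < nat (\<Sum>v\<in>V. \<bar>?d v - b v\<bar>)"
        by linarith
      from less.IH[OF this T'] show ?thesis .
    qed
  qed
  then show ?thesis using ex_tournament[OF fin ne] by blast
qed

text \<open>With \<open>P\<close> non-negative and \<open>Q\<close> negative entries,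
  \<open>card A + card (V - A) = P + Q\<close>. If \<open>card A\<close> is at most
  \<open>Q\<close>, then \<open>card (V - A)\<close> is at least \<open>P\<close>, and the lower
  bound \<open>- P\<close> on each entry of \<open>A\<close> suffices. Otherwise the upper bound
  \<open>Q\<close> is summed over \<open>V - A\<close>, whose sum is the negative of that over
  \<open>A\<close>.\<close>

corollary landau_sign_counts:
  fixes b :: "'a \<Rightarrow> int"
  assumes fin: "finite V" and ne: "V \<noteq> {}"
    and sum0: "(\<Sum>v\<in>V. b v) = 0"
    and parity: "\<And>v. v \<in> V \<Longrightarrow> even (b v) \<longleftrightarrow> odd (card V)"
    and upper: "\<And>v. v \<in> V \<Longrightarrow> b v \<le> int (card {v \<in> V. b v < 0})"
    and lower: "\<And>v. v \<in> V \<Longrightarrow> - int (card {v \<in> V. 0 \<le> b v}) \<le> b v"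
  shows "\<exists>T. tournament T \<and> pverts T = V \<and> (\<forall>v\<in>V. imbalance (with_proj T) v = b v)"
proof (rule landau[OF fin ne sum0 parity])
  fix A assume A: "A \<subseteq> V"
  define P Q where "P = int (card {v \<in> V. 0 \<le> b v})" and "Q = int (card {v \<in> V. b v < 0})"
  have finA: "finite A" using A fin by (rule finite_subset)
  have "card V = card ({v \<in> V. 0 \<le> b v} \<union> {v \<in> V. b v < 0})"
    by (rule arg_cong[of _ _ card]) auto
  also have "\<dots> = card {v \<in> V. 0 \<le> b v} + card {v \<in> V. b v < 0}"
    using fin by (intro card_Un_disjoint) auto
  finally have "int (card V) = P + Q" by (simp add: P_def Q_def)
  moreover have "card V = card A + card (V - A)"
    using A finA fin by (metis card_Diff_subset card_mono le_add_diff_inverse)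
  ultimately have PQ: "int (card A) + int (card (V - A)) = P + Q" by simp
  show "- (int (card A) * int (card (V - A))) \<le> (\<Sum>v\<in>A. b v)"
  proof (cases "int (card A) \<le> Q")
    case True
    then have "- (int (card A) * int (card (V - A))) \<le> - (int (card A) * P)"
      using PQ by (simp add: mult_left_mono)
    also have "\<dots> = (\<Sum>v\<in>A. - P)" by simp
    also have "\<dots> \<le> (\<Sum>v\<in>A. b v)"
      using lower A by (intro sum_mono) (auto simp: P_def)
    finally show ?thesis .
  next
    case False
    have "(\<Sum>v\<in>V - A. b v) \<le> (\<Sum>v\<in>V - A. Q)"
      using upper by (intro sum_mono) (auto simp: Q_def)
    also have "\<dots> = Q * int (card (V - A))" by simp
    also have "\<dots> \<le> int (card A) * int (card (V - A))"
      using False by (intro mult_right_mono) auto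
    finally show ?thesis
      using sum.subset_diff[OF A fin, of b] sum0 by linarith
  qed
qed

section \<open>From multiplicities to tournaments\<close>

lemma tournament_ord_le_sum_multiplicities:
  fixes Z :: "int set" and c :: "int \<Rightarrow> nat"
  assumes fin: "finite Z" and ne: "Z \<noteq> {}"
    and pos: "\<And>z. z \<in> Z \<Longrightarrow> 0 < c z"
    and sum0: "(\<Sum>z\<in>Z. int (c z) * z) = 0"
    and parity: "\<And>z. z \<in> Z \<Longrightarrow> even z \<longleftrightarrow> odd (\<Sum>z\<in>Z. c z)"
    and upper: "\<And>z. z \<in> Z \<Longrightarrow> z \<le> int (\<Sum>z\<in>{z \<in> Z. z < 0}. c z)"
    and lower: "\<And>z. z \<in> Z \<Longrightarrow> - int (\<Sum>z\<in>{z \<in> Z. 0 \<le> z}. c z) \<le> z"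
  shows "tournament_ord Z \<le> (\<Sum>z\<in>Z. c z)"
proof -
  \<comment> \<open>The pair \<open>(z, i)\<close> stands for copy \<open>i\<close> of
    \<open>z\<close>. It is encoded as a natural number because \<open>tournament_ord\<close> ranges
    over tournaments on \<open>nat\<close>.\<close>
  define S where "S W = (SIGMA z:W. {..<c z})" for W :: "int set"
  define V :: "nat set" where "V = to_nat ` S Z"
  define b where "b v = fst (from_nat v :: int \<times> nat)" for v
  have inj: "inj_on to_nat A" for A :: "(int \<times> nat) set"
    by (rule inj_on_subset[OF inj_to_nat]) simp
  have card_S: "card (S W) = (\<Sum>z\<in>W. c z)" if "W \<subseteq> Z" for W
    unfolding S_def using finite_subset[OF that fin] by simp
  have filter_V: "card {v \<in> V. R (b v)} = (\<Sum>z\<in>{z \<in> Z. R z}. c z)" for R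
  proof -
    have "{v \<in> V. R (b v)} = to_nat ` S {z \<in> Z. R z}"
      by (auto simp: V_def S_def b_def)
    then show ?thesis using card_S[of "{z \<in> Z. R z}"] by (simp add: card_image inj)
  qed
  have card_V: "card V = (\<Sum>z\<in>Z. c z)"
    using filter_V[of "\<lambda>_. True"] by simp
  have bV: "b v \<in> Z" if "v \<in> V" for v using that by (auto simp: V_def S_def b_def)
  have "(\<Sum>v\<in>V. b v) = (\<Sum>p\<in>S Z. fst p)"
    unfolding V_def by (simp add: sum.reindex[OF inj] b_def)
  also have "\<dots> = (\<Sum>z\<in>Z. \<Sum>i<c z. z)"
    unfolding S_def using fin by (subst sum.Sigma) (auto intro!: sum.cong)
  finally have sumV: "(\<Sum>v\<in>V. b v) = 0" using sum0 by simp
  have bV_image: "b ` V = Z"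
  proof
    show "b ` V \<subseteq> Z" using bV by auto
    show "Z \<subseteq> b ` V"
    proof
      fix z assume "z \<in> Z"
      then have "to_nat (z, 0 :: nat) \<in> V" using pos by (auto simp: V_def S_def)
      then show "z \<in> b ` V" by (intro image_eqI[of _ _ "to_nat (z, 0 :: nat)"]) (simp_all add: b_def)
    qed
  qed
  have "\<exists>T. tournament T \<and> pverts T = V \<and> (\<forall>v\<in>V. imbalance (with_proj T) v = b v)"
  proof (rule landau_sign_counts)
    show "finite V" using fin by (simp add: V_def S_def)
    show "V \<noteq> {}" using bV_image ne by auto
  qed (use sumV bV parity upper lower filter_V[of "\<lambda>z. z < 0"] filter_V[of "\<lambda>z. 0 \<le> z"]
      in \<open>simp_all add: card_V\<close>)
  then obtain T where T: "tournament T" "pverts T = V" "\<forall>v\<in>V. imbalance (with_proj T) v = b v"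
    by blast
  then have "imbalance_set (with_proj T) = Z"
    using bV_image by (simp add: imbalance_set_def)
  then show ?thesis
    unfolding tournament_ord_def using T card_V by (intro Least_le) auto
qed

section \<open>Balanced multiplicities\<close>

text \<open>\<open>M\<close> copies of each element of \<open>X\<close> and \<open>L\<close> of each
  element of \<open>Y\<close> sum to \<open>M * L - L * M = 0\<close>. The function \<open>e\<close>
  supplies further copies of sum zero, by which the order gets the right parity.\<close>

lemma tournament_ord_le_excess:
  fixes Z X Y :: "int set" and L M n :: int and e :: "int \<Rightarrow> nat"
  assumes fin: "finite Z"
    and X: "X = {z \<in> Z. 0 \<le> z}" and Y: "Y = {z \<in> Z. z < 0}"
    and L: "L = (\<Sum>x\<in>X. x)" and M: "M = (\<Sum>y\<in>Y. - y)"
    and n: "n = int (card X) * M + int (card Y) * L"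
    and posneg: "0 < L" "0 < M"
    and e0: "(\<Sum>z\<in>Z. int (e z) * z) = 0"
    and parity: "\<And>z. z \<in> Z \<Longrightarrow> even z \<longleftrightarrow> odd (n + (\<Sum>z\<in>Z. int (e z)))"
  shows "int (tournament_ord Z) \<le> n + (\<Sum>z\<in>Z. int (e z))"
proof -
  define c where "c z = (if 0 \<le> z then nat M else nat L) + e z" for z
  have finXY: "finite X" "finite Y" using fin by (simp_all add: X Y)
  have Z: "Z = X \<union> Y" "X \<inter> Y = {}" by (auto simp: X Y)
  note split = sum.union_disjoint[OF finXY Z(2), folded Z(1)]
  have "X \<noteq> {}" "Y \<noteq> {}" using posneg by (auto simp: L M)
  then have card1: "1 \<le> int (card X)" "1 \<le> int (card Y)"
    using finXY by (simp_all add: card_gt_0_iff Suc_le_eq)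
  have cX: "int (c z) = M + int (e z)" if "z \<in> X" for z
    using that posneg by (simp add: c_def X)
  have cY: "int (c z) = L + int (e z)" if "z \<in> Y" for z
    using that posneg by (simp add: c_def Y)
  have sum_cX: "int (\<Sum>z\<in>X. c z) = int (card X) * M + (\<Sum>z\<in>X. int (e z))"
    using cX by (simp add: sum.distrib)
  have sum_cY: "int (\<Sum>z\<in>Y. c z) = int (card Y) * L + (\<Sum>z\<in>Y. int (e z))"
    using cY by (simp add: sum.distrib)
  have total: "int (\<Sum>z\<in>Z. c z) = n + (\<Sum>z\<in>Z. int (e z))"
    unfolding n using sum_cX sum_cY split[of c] split[of "\<lambda>z. int (e z)"] by simp
  \<comment> \<open>An element of \<open>X\<close> is at most \<open>L\<close> and a negated element
    of \<open>Y\<close> at most \<open>M\<close>, so it suffices to have at least \<open>L\<close>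
    negative and \<open>M\<close> non-negative copies.\<close>
  have "M \<le> int (card X) * M" "L \<le> int (card Y) * L"
    using card1 posneg by simp_all
  then have big: "M \<le> int (\<Sum>z\<in>X. c z)" "L \<le> int (\<Sum>z\<in>Y. c z)"
    unfolding sum_cX sum_cY by (simp_all add: add_increasing2 sum_nonneg)
  have "(\<Sum>z\<in>Z. int (c z) * z) = 0"
  proof -
    have "(\<Sum>z\<in>X. int (c z) * z) = M * L + (\<Sum>z\<in>X. int (e z) * z)"
      unfolding L sum_distrib_left using cX by (simp add: sum.distrib distrib_right)
    moreover have "(\<Sum>z\<in>Y. int (c z) * z) = - (L * M) + (\<Sum>z\<in>Y. int (e z) * z)"
      unfolding M sum_distrib_left using cY by (simp add: sum.distrib distrib_right sum_negf)
    ultimately show ?thesis using e0 split[of "\<lambda>z. int (c z) * z"] split[of "\<lambda>z. int (e z) * z"] by simp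
  qed
  moreover have "z \<le> int (\<Sum>z\<in>{z \<in> Z. z < 0}. c z)" if "z \<in> Z" for z
  proof (cases "z \<in> X")
    case True
    then have "z \<le> L" unfolding L using finXY by (intro member_le_sum) (auto simp: X)
    then show ?thesis using big by (simp flip: Y)
  next
    case False
    with that have "z < 0" by (auto simp: X)
    then show ?thesis by linarith
  qed
  moreover have "- int (\<Sum>z\<in>{z \<in> Z. 0 \<le> z}. c z) \<le> z" if "z \<in> Z" for z
  proof (cases "z \<in> Y")
    case True
    then have "- z \<le> M" unfolding M using finXY by (intro member_le_sum) (auto simp: Y)
    then show ?thesis using big by (simp flip: X)
  next
    case False
    with that have "0 \<le> z" by (auto simp: Y)
    then show ?thesis by linarith
  qed
  moreover have "even z \<longleftrightarrow> odd (\<Sum>z\<in>Z. c z)" if "z \<in> Z" for z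
    using parity[OF that] total by (metis even_of_nat)
  moreover have "0 < c z" for z using posneg by (simp add: c_def)
  moreover have "Z \<noteq> {}" using \<open>X \<noteq> {}\<close> Z by auto
  ultimately have "tournament_ord Z \<le> (\<Sum>z\<in>Z. c z)"
    using fin by (intro tournament_ord_le_sum_multiplicities) auto
  then show ?thesis using total by linarith
qed

section \<open>Signs and parities in a zero sum\<close>

lemma sum_eq_0_imp_signs:
  fixes f :: "'a \<Rightarrow> int"
  assumes fin: "finite V" and sum0: "(\<Sum>v\<in>V. f v) = 0" and v: "v \<in> V" "f v \<noteq> 0"
  shows "\<exists>u\<in>V. 0 < f u" and "\<exists>u\<in>V. f u < 0"
proof -
  have *: "\<exists>u\<in>V. 0 < g u" if "(\<Sum>v\<in>V. g v) = 0" "g v \<noteq> 0" for g :: "'a \<Rightarrow> int"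
  proof (rule ccontr)
    assume "\<not> ?thesis"
    then have "\<forall>u\<in>V. g u \<le> 0" by force
    then have "(\<Sum>u\<in>V. g u) < (\<Sum>u\<in>V. 0)"
      using fin v(1) that(2) by (intro sum_strict_mono_ex1) (auto simp: order.order_iff_strict)
    with that(1) show False by simp
  qed
  show "\<exists>u\<in>V. 0 < f u" using *[OF sum0 v(2)] .
  show "\<exists>u\<in>V. f u < 0" using *[of "\<lambda>u. - f u"] sum0 v(2) by (simp add: sum_negf)
qed

lemma ex_odd_difference_div_Gcd:
  fixes f :: "'a \<Rightarrow> int"
  assumes fin: "finite V" and card: "odd (card V)" and sum0: "(\<Sum>v\<in>V. f v) = 0"
    and nz: "0 \<notin> f ` V"
  shows "\<exists>x\<in>f ` V. \<exists>y\<in>f ` V. y < 0 \<and> 0 < x \<and> odd ((x - y) div Gcd (f ` V))"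
proof (rule ccontr)
  assume contra: "\<not> ?thesis"
  define g where "g = Gcd (f ` V)"
  have ne: "V \<noteq> {}" using card by auto
  then have "g \<noteq> 0" using nz by (auto simp: g_def Gcd_0_iff)
  have dvd: "g dvd f v" if "v \<in> V" for v using that by (simp add: g_def)
  obtain v where "v \<in> V" using ne by blast
  then have "f v \<noteq> 0" using nz by (metis imageI)
  with sum_eq_0_imp_signs[OF fin sum0 \<open>v \<in> V\<close>] obtain u w
    where u: "u \<in> V" "0 < f u" and w: "w \<in> V" "f w < 0" by blast
  have same: "even (f x div g) \<longleftrightarrow> even (f y div g)" if "x \<in> V" "y \<in> V" "f y < 0" "0 < f x" for x y
  proof -
    have "even ((f x - f y) div g)" using contra that by (auto simp: g_def)
    then show ?thesis using dvd that by (simp add: div_diff)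
  qed
  \<comment> \<open>The assumption compares only values of opposite sign. A negative value is
    compared with \<open>f u\<close> directly, a positive one by way of \<open>f w\<close>.\<close>
  have all: "even (f v div g) \<longleftrightarrow> even (f u div g)" if "v \<in> V" for v
  proof (cases "0 < f v")
    case True
    then show ?thesis using same[OF that w(1) w(2)] same[OF u(1) w(1) w(2) u(2)] by simp
  next
    case False
    then have "f v < 0" using nz that by (metis imageI linorder_neqE_linordered_idom)
    then show ?thesis using same[OF u(1) that _ u(2)] by simp
  qed
  show False
  proof (cases "even (f u div g)")
    case True
    have "g * 2 dvd f v" if "v \<in> V" for v
      using all[OF that] True dvd[OF that] by (metis dvd_mult_div_cancel mult_dvd_mono dvd_refl)
    then have "g * 2 dvd g" unfolding g_def by (intro Gcd_greatest) auto
    then show False using \<open>g \<noteq> 0\<close> by simp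
  next
    case False
    have "g * (\<Sum>v\<in>V. f v div g) = (\<Sum>v\<in>V. f v)"
      unfolding sum_distrib_left using dvd by (intro sum.cong) auto
    then have "even (\<Sum>v\<in>V. f v div g)" using sum0 \<open>g \<noteq> 0\<close> by simp
    moreover have "{v \<in> V. odd (f v div g)} = V" using all False by auto
    ultimately show False using fin card by (simp add: even_sum_iff)
  qed
qed

section \<open>The three bounds\<close>

theorem theorem4p5:
  fixes Z X Y :: "int set" and l m L M n :: int and T :: "'v pair_pre_digraph"
  assumes "finite Z"
    and "tournament T" and "imbalance_set (with_proj T) = Z"
    and "X = {z \<in> Z. 0 \<le> z}" and "Y = {z \<in> Z. z < 0}"
    and "l = int (card X)" and "m = int (card Y)"
    and "L = (\<Sum>x\<in>X. x)" and "M = (\<Sum>y\<in>Y. - y)"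
    and "n = l * M + m * L"
  shows "((\<forall>z\<in>Z. odd z) \<longrightarrow> int (tournament_ord Z) \<le> n) \<and>
    ((\<forall>z\<in>Z. even z) \<and> 0 \<in> Z \<longrightarrow> int (tournament_ord Z) \<le> n + 1) \<and>
    ((\<forall>z\<in>Z. even z) \<and> 0 \<notin> Z \<longrightarrow> int (tournament_ord Z) < 2 * n)"
proof -
  interpret tournament T by (rule assms(2))
  define V where "V = pverts T"
  define f where "f = imbalance (with_proj T)"
  have Z: "Z = f ` V" using assms(3) by (simp add: imbalance_set_def f_def V_def)
  have finV: "finite V" by (simp add: V_def)
  have neV: "V \<noteq> {}" using verts_nonempty by (simp add: V_def)
  have sum0: "(\<Sum>v\<in>V. f v) = 0" using sum_imbalance_eq_0 by (simp add: f_def V_def)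
  have finXY: "finite X" "finite Y" using assms(1,4,5) by simp_all
  have le_L: "x \<le> L" if "x \<in> Z" "0 < x" for x
    unfolding assms(8) using finXY that by (intro member_le_sum) (auto simp: assms(4))
  have le_M: "- y \<le> M" if "y \<in> Z" "y < 0" for y
    unfolding assms(9) using finXY that by (intro member_le_sum) (auto simp: assms(5))
  \<comment> \<open>A nonzero imbalance forces imbalances of both signs, since they sum to
    zero.\<close>
  have LM: "0 < L" "0 < M" if z: "z \<in> Z" "z \<noteq> 0" for z
  proof -
    obtain v where "v \<in> V" "f v \<noteq> 0" using z Z by auto
    from sum_eq_0_imp_signs[OF finV sum0 this] obtain x y
      where "x \<in> Z" "0 < x" "y \<in> Z" "y < 0" using Z by blast
    then show "0 < L" "0 < M" using le_L[of x] le_M[of y] by simp_all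
  qed
  have n: "n = int (card X) * M + int (card Y) * L" using assms(6,7,10) by simp
  note excess = tournament_ord_le_excess[OF assms(1,4,5,8,9) n]
  have even_n: "even n" if "\<forall>z\<in>Z. even z"
  proof -
    have "even L" "even M"
      using that unfolding assms(4,5,8,9) by (auto intro!: dvd_sum)
    then show ?thesis by (simp add: n)
  qed
  have "int (tournament_ord Z) \<le> n" if odd: "\<forall>z\<in>Z. odd z"
  proof -
    obtain z where z: "z \<in> Z" using Z neV by auto
    then have "z \<noteq> 0" using odd by force
    \<comment> \<open>Modulo 2, \<open>L\<close> is \<open>card X\<close> and \<open>M\<close> is
      \<open>card Y\<close>, so \<open>n\<close> is twice \<open>card X * card Y\<close>, hence
      even.\<close>
    have "{x \<in> X. odd x} = X" "{y \<in> Y. odd (- y)} = Y"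
      using odd by (auto simp: assms(4,5))
    then have "even L \<longleftrightarrow> even (card X)" "even M \<longleftrightarrow> even (card Y)"
      unfolding assms(8,9) using finXY by (simp_all only: even_sum_iff)
    then have "even n" by (auto simp: n)
    then show ?thesis using excess[of "\<lambda>_. 0"] LM[OF z \<open>z \<noteq> 0\<close>] odd by simp
  qed
  moreover have "int (tournament_ord Z) \<le> n + 1" if even: "\<forall>z\<in>Z. even z" and "0 \<in> Z"
  proof (cases "Z = {0}")
    case True
    \<comment> \<open>Here \<open>L = M = 0\<close>, so \<open>excess\<close> does not apply; the
      one-vertex tournament attains the bound \<open>n + 1 = 1\<close>.\<close>
    have "tournament_ord {0} \<le> (\<Sum>z\<in>{0 :: int}. 1)"
      by (rule tournament_ord_le_sum_multiplicities) auto
    moreover have "X = {0}" "Y = {}" using True by (auto simp: assms(4,5))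
    ultimately show ?thesis using True by (simp add: n assms(8,9))
  next
    case False
    then obtain z where "z \<in> Z" "z \<noteq> 0" using \<open>0 \<in> Z\<close> by blast
    have "(\<Sum>z\<in>Z. int (of_bool (z = 0))) = (\<Sum>z\<in>Z. if 0 = z then 1 else 0)"
      by (intro sum.cong) auto
    also have "\<dots> = 1" using assms(1) \<open>0 \<in> Z\<close> by simp
    finally have one: "(\<Sum>z\<in>Z. int (of_bool (z = 0))) = 1" .
    moreover have "(\<Sum>z\<in>Z. int (of_bool (z = 0)) * z) = 0"
      by (intro sum.neutral) auto
    ultimately show ?thesis
      using excess[of "\<lambda>z. of_bool (z = 0)"] LM[OF \<open>z \<in> Z\<close> \<open>z \<noteq> 0\<close>] even even_n by simp
  qed
  moreover have "int (tournament_ord Z) < 2 * n" if even: "\<forall>z\<in>Z. even z" and "0 \<notin> Z"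
  proof -
    define g where "g = Gcd Z"
    \<comment> \<open>Even imbalances force the given tournament to have odd order, which rules out
      that all quotients by \<open>g\<close> are odd.\<close>
    have "even (f v)" if "v \<in> V" for v using even that Z by auto
    then have "odd (card V)" using neV even_imbalance_iff by (auto simp: f_def V_def)
    from ex_odd_difference_div_Gcd[OF finV this sum0] \<open>0 \<notin> Z\<close> obtain x y
      where xy: "x \<in> Z" "0 < x" "y \<in> Z" "y < 0" and odd: "odd ((x - y) div g)"
      unfolding Z g_def by blast
    have "even g" unfolding g_def using even by (intro Gcd_greatest) auto
    moreover have "g \<noteq> 0" using odd by auto
    moreover have "0 \<le> g" by (simp add: g_def)
    ultimately have g2: "2 \<le> g" by presburger
    define p q where "p = x div g" and "q = - y div g"
    have xg: "x = g * p" and yg: "- y = g * q"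
      using xy by (simp_all add: p_def q_def g_def)
    have pq0: "0 \<le> p" "0 \<le> q" using xy g2 by (simp_all add: p_def q_def pos_imp_zdiv_nonneg_iff)
    have "x - y = g * (p + q)" using xg yg by (simp add: distrib_left)
    then have odd_pq: "odd (p + q)" using odd g2 by simp
    \<comment> \<open>\<open>q\<close> further copies of \<open>x\<close> and \<open>p\<close> of \<open>y\<close> keep the sum zero, as \<open>q x + p y = 0\<close>,
      and make the order odd.\<close>
    define e where "e z = (if z = x then nat q else 0) + (if z = y then nat p else 0)" for z
    have e: "int (e z) = (if x = z then q else 0) + (if y = z then p else 0)" for z
      using pq0 by (simp add: e_def)
    have sum_e: "(\<Sum>z\<in>Z. int (e z)) = p + q"
      using xy assms(1) by (simp add: e sum.distrib)
    have "(\<Sum>z\<in>Z. int (e z) * z) = (\<Sum>z\<in>Z. (if x = z then q * x else 0) + (if y = z then p * y else 0))"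
      by (intro sum.cong) (auto simp: e distrib_right)
    also have "\<dots> = q * x + p * y"
      using xy assms(1) by (simp add: sum.distrib)
    also have "\<dots> = 0"
    proof -
      have "y = - (g * q)" using yg by simp
      then show ?thesis by (simp add: xg)
    qed
    finally have le: "int (tournament_ord Z) \<le> n + (p + q)"
      using excess[of e] LM[of x] xy even even_n odd_pq by (simp add: sum_e)
    \<comment> \<open>The number of added vertices is bounded by
      \<open>2 * (p + q) \<le> g * (p + q) = x - y \<le> L + M \<le> n\<close>.\<close>
    have "2 * (p + q) \<le> g * (p + q)" using g2 pq0 by (intro mult_right_mono) auto
    also have "\<dots> \<le> L + M"
      using \<open>x - y = g * (p + q)\<close> le_L[of x] le_M[of y] xy by linarith
    also have "\<dots> \<le> n"
    proof -
      have "X \<noteq> {}" "Y \<noteq> {}" using xy by (auto simp: assms(4,5))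
      then have "1 \<le> int (card X)" "1 \<le> int (card Y)"
        using finXY by (simp_all add: card_gt_0_iff Suc_le_eq)
      then have "1 * M \<le> int (card X) * M" "1 * L \<le> int (card Y) * L"
        using LM[of x] xy by (intro mult_right_mono; simp)+
      then show ?thesis by (simp add: n)
    qed
    finally have "2 * (p + q) \<le> n" .
    \<comment> \<open>This makes the bound strict:
      \<open>n + (p + q) < n + 2 * (p + q) \<le> 2 * n\<close>.\<close>
    moreover have "0 < p + q" using odd_pq pq0 by presburger
    ultimately show ?thesis using le by arith
  qed
  ultimately show ?thesis by blast
qed

end
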